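(* Let $p = p_1p_2\ldots p_m$ and $w = w_1w_2\ldots w_n$ be binary words such that $p$ occurs in $w$. Write $p = A_1A_2\ldots A_r$ as the concatenation of its $r$ runs and $w = B_1B_2\ldots B_s$ as the concatenation of its $s$ runs. Let $l \in [n]$ and suppose the letter $w_l$ belongs neither to $\mathrm{L}_p(w)$ nor to $\mathrm{R}_p(w)$. Then: (1) If $\mathrm{Llet}_w(\psi_p^j[w],|A_{r-j+1}|) < l < \mathrm{Rlet}_w(\phi(B_{\mathrm{L}_p^{r-j+1}(w)}),|A_{r-j+1}|)$ for some $j\in[r]$, then $w_l$ is not contained in any occurrence of $p$ in $w$. (2) If $l < \mathrm{Rlet}_w(\phi(B_{\mathrm{L}_p^{1}(w)}),|A_1|)$ or $l > \mathrm{Llet}_w(\psi_p^1[w],|A_r|)$, then $w_l$ is not contained in any occurrence of $p$ in $w$. (3) Otherwise, $w_l$ is contained in an occurrence of $p$ in $w$.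
   Context: A run of a binary word is a maximal block of consecutive identical letters; its parity is even if it consists of 0's and odd if it consists of 1's. A subword of $w$ is obtained by deleting letters and is identified with its tuple of indices in $w$; an occurrence of $p$ in $w$ is a subword equal to $p$, and a letter $w_l$ belongs to (is contained in) an occurrence if $l$ is one of its indices. For a run $B_i$ of $w$, $\phi(B_i)$ and $\psi(B_i)$ are the indices in $w$ of its first and last letters. For runs $B_i,B_j$ of the same parity, $\sigma(w;i,j) := \sum_{k=0}^{(j-i)/2}|B_{i+2k}|$, and $\lambda(w;i;j) := \min\{k \mid \sigma(w;i-2k,i)\ge j\}$. Define $\zeta_p^w := s$ if $A_r$ and $B_s$ have the same parity and $s-1$ otherwise. For $j\in[n]$ and a positive integer $k$, $\mathrm{Llet}_w(j,k)$ is the index $i\le j$ such that $w_i = w_j$ and exactly $k$ letters among $w_i,\ldots,w_j$ equal $w_j$ (the $(k-1)$st same-parity letter to the left of $w_j$); $\mathrm{Rlet}_w(j,k)$ is defined analogously to the right. The lexicographically minimal occurrence $\mathrm{L}_p(w)$ is the occurrence such that for every occurrence $p'$ and every $j\in[m]$ the $j$th letter of $p'$ is not left of the $j$th letter of $\mathrm{L}_p(w)$; the lexicographically maximal occurrence $\mathrm{R}_p(w)$ is the occurrence such that for every occurrence $p'$ and every $j$ the $j$th letter of $p'$ is not right of the $j$th letter of $\mathrm{R}_p(w)$. Writing $\mathrm{L}_p(w) = L_1\ldots L_r$ with $L_i$ corresponding to $A_i$, the head $\mathrm{L}_p^i(w)$ is the index of the run of $w$ containing the first letter of $L_i$. Define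 $\mathrm{R}_p^1(w) := \zeta_p^w$ and $\mathrm{R}_p^{i+1}(w) := \mathrm{R}_p^i(w) - 2\lambda(w;\mathrm{R}_p^i(w);|A_{r-i+1}|) - 1$, and $\psi_p^i[w] := \psi(B_{\mathrm{R}_p^i(w)})$.
   Formalization: Part (3) is proved under the added assumption that the letter w_l occurs in p, which is automatic when p has at least two runs; without it (3) fails, e.g. for p = 0, w = 010, l = 2. *)

theory Defs
  imports Main
begin

(* Binary words are of type bool list, with False for 0 and True for 1. All indices (of letters,
   of runs, and the iteration index of maxrun) start at 1; values of the functions below at
   indices out of range carry no meaning. *)

definition letter :: "'a list \<Rightarrow> nat \<Rightarrow> 'a" where
  "letter w i = w ! (i - 1)"


subsection \<open>Runs\<close>

function runs :: "'a list \<Rightarrow> 'a list list" where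
  "runs [] = []"
| "runs (x # xs) = (x # takeWhile (\<lambda>y. y = x) xs) # runs (dropWhile (\<lambda>y. y = x) xs)"
  by pat_completeness auto
termination
  by (relation "measure length") (auto simp: less_Suc_eq_le length_dropWhile_le)

lemma concat_runs: "concat (runs w) = w"
  by (induction w rule: runs.induct) auto

lemma runs_constant: "B \<in> set (runs w) \<Longrightarrow> B \<noteq> [] \<and> (\<forall>x\<in>set B. x = hd B)"
proof (induction w rule: runs.induct)
  case (2 x xs)
  show ?case
  proof (cases "B = x # takeWhile (\<lambda>y. y = x) xs")
    case True
    then show ?thesis
      by (auto dest: set_takeWhileD)
  next
    case False
    then show ?thesis
      using 2 by simp
  qed
qed simp

lemma hd_hd_runs: "w \<noteq> [] \<Longrightarrow> runs w \<noteq> [] \<and> hd (hd (runs w)) = hd w"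
  by (cases w) auto

lemma runs_maximal: "successively (\<lambda>B C. hd B \<noteq> hd C) (runs w)"
proof (induction w rule: runs.induct)
  case (2 x xs)
  let ?ys = "dropWhile (\<lambda>y. y = x) xs"
  show ?case
  proof (cases "?ys = []")
    case False
    then have "hd ?ys \<noteq> x"
      using hd_dropWhile[of "\<lambda>y. y = x" xs] by simp
    then show ?thesis
      using 2 hd_hd_runs[OF False] by (simp add: successively_Cons)
  next
    case True
    then show ?thesis
      by (simp only: runs.simps successively.simps)
  qed
qed simp

definition num_runs :: "'a list \<Rightarrow> nat" where
  "num_runs w = length (runs w)"

definition run :: "'a list \<Rightarrow> nat \<Rightarrow> 'a list" where
  "run w i = runs w ! (i - 1)"

(* True = odd (a run of 1's), False = even (a run of 0's). *)
definition parity :: "bool list \<Rightarrow> bool" where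
  "parity B = hd B"

definition phi :: "'a list \<Rightarrow> nat \<Rightarrow> nat" where
  "phi w i = (\<Sum>k\<in>{1..<i}. length (run w k)) + 1"

definition psi :: "'a list \<Rightarrow> nat \<Rightarrow> nat" where
  "psi w i = (\<Sum>k\<in>{1..i}. length (run w k))"

definition sigma :: "'a list \<Rightarrow> nat \<Rightarrow> nat \<Rightarrow> nat" where
  "sigma w i j = (\<Sum>k=0..(j - i) div 2. length (run w (i + 2 * k)))"

(* The conjunct 2 * k < i says that i - 2 * k is the index of a run; it guards against truncated
   subtraction. *)
definition lambda :: "'a list \<Rightarrow> nat \<Rightarrow> nat \<Rightarrow> nat" where
  "lambda w i j = (LEAST k. 2 * k < i \<and> sigma w (i - 2 * k) i \<ge> j)"


subsection \<open>Occurrences\<close>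

definition occurrences :: "'a list \<Rightarrow> 'a list \<Rightarrow> nat list set" where
  "occurrences p w =
     {is. sorted_wrt (<) is \<and> set is \<subseteq> {1..length w} \<and> map (letter w) is = p}"

definition lexmin :: "'a list \<Rightarrow> 'a list \<Rightarrow> nat list" where
  "lexmin p w = (THE is. is \<in> occurrences p w \<and>
     (\<forall>is'\<in>occurrences p w. \<forall>j\<in>{1..length p}. letter is j \<le> letter is' j))"

definition lexmax :: "'a list \<Rightarrow> 'a list \<Rightarrow> nat list" where
  "lexmax p w = (THE is. is \<in> occurrences p w \<and>
     (\<forall>is'\<in>occurrences p w. \<forall>j\<in>{1..length p}. letter is' j \<le> letter is j))"

definition Llet :: "'a list \<Rightarrow> nat \<Rightarrow> nat \<Rightarrow> nat" where
  "Llet w j k = (THE i. i \<in> {1..j} \<and> letter w i = letter w j \<and>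
     card {t \<in> {i..j}. letter w t = letter w j} = k)"

definition Rlet :: "'a list \<Rightarrow> nat \<Rightarrow> nat \<Rightarrow> nat" where
  "Rlet w j k = (THE i. i \<in> {j..length w} \<and> letter w i = letter w j \<and>
     card {t \<in> {j..i}. letter w t = letter w j} = k)"

(* The letters of the lexicographically minimal occurrence that correspond to the i-th run of p
   start at position phi p i of that occurrence. *)
definition head :: "'a list \<Rightarrow> 'a list \<Rightarrow> nat \<Rightarrow> nat" where
  "head p w i = (THE k. k \<in> {1..num_runs w} \<and>
     letter (lexmin p w) (phi p i) \<in> {phi w k..psi w k})"

definition zeta :: "bool list \<Rightarrow> bool list \<Rightarrow> nat" where
  "zeta p w =
     (if parity (run p (num_runs p)) = parity (run w (num_runs w))
      then num_runs w else num_runs w - 1)"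

(* maxrun p w i is the run index written R_p^i(w); psi_max p w i is psi_p^i[w]. The equation for
   0 is a dummy. *)
fun maxrun :: "bool list \<Rightarrow> bool list \<Rightarrow> nat \<Rightarrow> nat" where
  "maxrun p w 0 = 0"
| "maxrun p w (Suc 0) = zeta p w"
| "maxrun p w (Suc (Suc i)) =
     maxrun p w (Suc i)
       - 2 * lambda w (maxrun p w (Suc i)) (length (run p (num_runs p - Suc i + 1))) - 1"

definition psi_max :: "bool list \<Rightarrow> bool list \<Rightarrow> nat \<Rightarrow> nat" where
  "psi_max p w i = psi w (maxrun p w i)"


subsection \<open>The hypotheses of the three cases\<close>

definition between_cond :: "bool list \<Rightarrow> bool list \<Rightarrow> nat \<Rightarrow> bool" where
  "between_cond p w l \<longleftrightarrow> (\<exists>j\<in>{1..num_runs p}.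
     Llet w (psi_max p w j) (length (run p (num_runs p - j + 1))) < l \<and>
     l < Rlet w (phi w (head p w (num_runs p - j + 1))) (length (run p (num_runs p - j + 1))))"

definition outer_cond :: "bool list \<Rightarrow> bool list \<Rightarrow> nat \<Rightarrow> bool" where
  "outer_cond p w l \<longleftrightarrow>
     l < Rlet w (phi w (head p w 1)) (length (run p 1)) \<or>
     l > Llet w (psi_max p w 1) (length (run p (num_runs p)))"

(* The claim that every other letter lies in an occurrence fails when p is a single run and the
   letter in question does not occur in p: for p = 0 and w = 010, the letter 1 of w satisfies
   neither of the two conditions above. That case must therefore be assumed
   away; as soon as p has two runs, both letters occur in p: *)
lemma set_eq_UNIV_if_two_runs:
  fixes p :: "bool list"
  assumes "2 \<le> num_runs p"
  shows "set p = UNIV"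
proof -
  from assms obtain A B Cs where runs: "runs p = A # B # Cs"
    unfolding num_runs_def by (metis Suc_le_length_iff numeral_2_eq_2)
  have "hd A \<noteq> hd B"
    using runs_maximal[of p] by (simp add: runs)
  moreover have "A \<noteq> []" "B \<noteq> []"
    using runs_constant[of A p] runs_constant[of B p] by (auto simp: runs)
  then have "hd A \<in> set p" "hd B \<in> set p"
    using concat_runs[of p] by (auto simp: runs)
  ultimately show ?thesis
    by (cases "hd A"; cases "hd B") (auto simp: UNIV_bool)
qed

end

theory Submission
  imports Defs
begin

text \<open>Write $L$ and $R$ for the lexicographically minimal and maximal occurrences, and $L(j)$, $R(j)$
  for their $j$th letters. No letter of $w$ strictly between $L(j-1)$ and $L(j)$ equals $p_j$, and
  dually for $R$. Hence the part of $L$ belonging to the run $A_k$ begins at the first letter of a run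
  of $w$ and uses up all letters of its parity until it ends, at an index $e_k$; the part of $R$
  belonging to $A_k$ ends at the last letter of a run of $w$, uses up all letters of its parity, and
  begins at an index $b_k$. The \<open>Rlet\<close> and \<open>Llet\<close> terms in the conditions are exactly $e_k$ and
  $b_k$, so condition (1) reads $b_k < l < e_k$ for some $k$, and condition (2) reads $l < e_1$ or
  $b_r < l$.

  A letter outside $L$ and $R$ that an occurrence uses for $A_k$ satisfies $e_k < l < b_k$, which is
  incompatible with both conditions because $e$ and $b$ increase. Conversely, if both conditions
  fail and $r \ge 2$, take the largest $k < r$ with $e_k < l$; then $l < b_{k+1}$. Splicing the
  beginning of $L$, the letter $w_l$ and the end of $R$ gives an occurrence, with $w_l$ as the last
  letter of $A_k$ or the first letter of $A_{k+1}$ according to its parity.\<close>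

section \<open>Runs as index intervals\<close>

lemma psi_0 [simp]: "psi u 0 = 0"
  by (simp add: psi_def)

lemma psi_Suc: "psi u (Suc i) = psi u i + length (run u (Suc i))"
  by (simp add: psi_def)

lemma phi_Suc: "phi u (Suc i) = Suc (psi u i)"
  by (simp add: phi_def psi_def atLeastLessThanSuc_atLeastAtMost)

lemma psi_mono: "i \<le> j \<Longrightarrow> psi u i \<le> psi u j"
  by (auto simp: psi_def intro!: sum_mono2)

lemma psi_less_phi: "i < j \<Longrightarrow> psi u i < phi u j"
  by (cases j) (simp_all add: phi_Suc less_Suc_eq_le psi_mono)

lemma psi_eq_length_concat:
  "i \<le> num_runs u \<Longrightarrow> psi u i = length (concat (take i (runs u)))"
  by (induction i) (auto simp: psi_Suc run_def num_runs_def take_Suc_conv_app_nth)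

lemma psi_num_runs: "psi u (num_runs u) = length u"
  using psi_eq_length_concat[of "num_runs u" u] by (simp add: num_runs_def concat_runs)

lemma run_in_set: "i \<in> {1..num_runs u} \<Longrightarrow> run u i \<in> set (runs u)"
  by (auto simp: run_def num_runs_def)

lemma psi_eq_phi:
  assumes "i \<in> {1..num_runs u}"
  shows "psi u i + 1 = phi u i + length (run u i)" "phi u i \<le> psi u i"
proof -
  have "run u i \<noteq> []"
    using runs_constant run_in_set[OF assms] by blast
  then show "psi u i + 1 = phi u i + length (run u i)" "phi u i \<le> psi u i"
    using assms phi_Suc[of u "i - 1"] psi_Suc[of u "i - 1"] by (cases "run u i"; simp)+
qed

lemma phi_psi_bounds:
  assumes "i \<in> {1..num_runs u}"
  shows "1 \<le> phi u i" "phi u i \<le> psi u i" "psi u i \<le> length u"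
  using assms psi_eq_phi[OF assms] psi_mono[of i "num_runs u" u] psi_num_runs[of u]
  by (auto simp: phi_def)

lemma letter_run:
  assumes i: "i \<in> {1..num_runs u}" and t: "t \<in> {phi u i..psi u i}"
  shows "letter u t = hd (run u i)"
proof -
  obtain k where k: "i = Suc k" "k < num_runs u"
    using i by (cases i) auto
  have "u = concat (take k (runs u) @ runs u ! k # drop (Suc k) (runs u))"
    using k id_take_nth_drop[of k "runs u"] concat_runs[of u] by (simp add: num_runs_def)
  then have u: "u = concat (take k (runs u)) @ run u i @ concat (drop (Suc k) (runs u))"
    by (simp add: run_def k)
  have len: "length (concat (take k (runs u))) = psi u k"
    using psi_eq_length_concat[of k u] k by simp
  have s: "psi u k \<le> t - 1" "t - 1 - psi u k < length (run u i)"
    using t k by (auto simp: phi_Suc psi_Suc)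
  have "u ! (t - 1) = run u i ! (t - 1 - psi u k)"
    by (subst u) (use s len in \<open>simp add: nth_append\<close>)
  then show ?thesis
    using runs_constant[OF run_in_set[OF i]] s nth_mem unfolding letter_def by metis
qed

lemma hd_run_Suc:
  assumes "1 \<le> i" "i < num_runs u"
  shows "hd (run u i) \<noteq> hd (run u (Suc i))"
  using runs_maximal[of u] assms
  by (cases i) (auto simp: successively_conv_nth run_def num_runs_def)

lemma ex_run:
  assumes "t \<in> {1..length u}"
  shows "\<exists>i\<in>{1..num_runs u}. t \<in> {phi u i..psi u i}"
proof -
  \<comment> \<open>The run containing \<open>t\<close> is the first one whose end reaches
    \<open>t\<close>; by minimality the preceding run ends before \<open>t\<close>.\<close>
  define i where "i = (LEAST i. t \<le> psi u i)"
  have ex: "t \<le> psi u (num_runs u)"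
    using assms psi_num_runs[of u] by simp
  have 1: "t \<le> psi u i" "i \<le> num_runs u"
    unfolding i_def by (rule LeastI, rule ex) (rule Least_le, rule ex)
  have "i \<noteq> 0"
    using 1 assms by (auto intro: ccontr)
  then obtain k where k: "i = Suc k"
    by (cases i) auto
  have "\<not> t \<le> psi u k"
    using not_less_Least[of k "\<lambda>i. t \<le> psi u i"] k i_def by auto
  then show ?thesis
    using 1 k by (intro bexI[of _ i]) (auto simp: phi_Suc)
qed

lemma letter_psi_Suc:
  assumes "1 \<le> i" "i < num_runs u"
  shows "letter u (psi u i) \<noteq> letter u (Suc (psi u i))"
proof -
  have "letter u (psi u i) = hd (run u i)" "letter u (Suc (psi u i)) = hd (run u (Suc i))"
    using assms phi_psi_bounds[of i u] phi_psi_bounds[of "Suc i" u]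
    by (auto intro!: letter_run simp: phi_Suc)
  then show ?thesis
    using hd_run_Suc[OF assms] by simp
qed

text \<open>Neighbouring runs differ and there are only two letters, so parities alternate along the
  word.\<close>

lemma hd_run_add:
  fixes u :: "bool list"
  assumes "1 \<le> i" "i + d \<le> num_runs u"
  shows "hd (run u (i + d)) = hd (run u i) \<longleftrightarrow> even d"
  using assms(2)
proof (induction d)
  case (Suc d)
  then show ?case
    using hd_run_Suc[of "i + d" u] assms(1) by auto
qed simp

text \<open>This turns \<open>sigma\<close> into a count of letters in an interval of indices, which
  can then be compared with the count along the maximal occurrence.\<close>

lemma sigma_eq_card:
  fixes u :: "bool list"
  assumes "1 \<le> i" "i + 2 * k \<le> num_runs u"
  shows "sigma u i (i + 2 * k) =
    card {t \<in> {phi u i..psi u (i + 2 * k)}. letter u t = hd (run u i)}"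
  using assms(2)
proof (induction k)
  case 0
  have "{t \<in> {phi u i..psi u i}. letter u t = hd (run u i)} = {phi u i..psi u i}"
    using letter_run[of i u] 0 assms(1) by auto
  then show ?case
    using psi_eq_phi[of i u] 0 assms(1) by (simp add: sigma_def)
next
  case (Suc k)
  let ?j = "i + 2 * k" and ?x = "hd (run u i)"
  have b: "?j \<in> {1..num_runs u}" "Suc ?j \<in> {1..num_runs u}" "Suc (Suc ?j) \<in> {1..num_runs u}"
    using Suc assms(1) by auto
  have x: "hd (run u (Suc ?j)) \<noteq> ?x" "hd (run u (Suc (Suc ?j))) = ?x"
    using hd_run_add[of i "Suc (2 * k)" u] hd_run_add[of i "Suc (Suc (2 * k))" u] Suc assms(1)
    by auto
  have ij: "phi u i \<le> psi u ?j"
    using phi_psi_bounds[of i u] psi_mono[of i ?j u] Suc assms(1) by auto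
  \<comment> \<open>Extending the interval by two runs adds one run of the other letter, which
    contributes nothing, and one run that is counted entirely.\<close>
  have "{t \<in> {phi u i..psi u (Suc (Suc ?j))}. letter u t = ?x} =
      {t \<in> {phi u i..psi u ?j}. letter u t = ?x} \<union> {phi u (Suc (Suc ?j))..psi u (Suc (Suc ?j))}"
    (is "?A = ?B \<union> ?C")
  proof (intro equalityI subsetI)
    fix t assume t: "t \<in> ?A"
    have "t \<notin> {phi u (Suc ?j)..psi u (Suc ?j)}"
      using letter_run[OF b(2), of t] t x by auto
    then show "t \<in> ?B \<union> ?C"
      using t by (auto simp: phi_Suc)
  next
    fix t assume "t \<in> ?B \<union> ?C"
    then show "t \<in> ?A"
      using letter_run[OF b(3), of t] x ij psi_mono[of ?j "Suc (Suc ?j)" u]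
        psi_mono[of ?j "Suc ?j" u]
      by (auto simp: phi_Suc)
  qed
  moreover have "?B \<inter> ?C = {}"
    using psi_less_phi[of ?j "Suc (Suc ?j)" u] by auto
  moreover have "sigma u i (Suc (Suc ?j)) = sigma u i ?j + length (run u (Suc (Suc ?j)))"
    by (simp add: sigma_def)
  moreover have "card ?C = length (run u (Suc (Suc ?j)))"
    using psi_eq_phi[OF b(3)] by simp
  ultimately show ?case
    using Suc by (simp add: card_Un_disjoint)
qed


section \<open>Occurrences\<close>

lemma letter_map_upt: "j \<in> {1..m} \<Longrightarrow> letter (map f [Suc 0..<Suc m]) j = f j"
  by (auto simp: letter_def simp del: upt_Suc)

lemma set_eq_letters: "set xs = letter xs ` {1..length xs}"
proof (intro equalityI subsetI)
  fix x assume "x \<in> set xs"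
  then obtain i where "i < length xs" "xs ! i = x"
    by (auto simp: in_set_conv_nth)
  then show "x \<in> letter xs ` {1..length xs}"
    by (intro image_eqI[of _ _ "Suc i"]) (auto simp: letter_def)
qed (auto simp: letter_def)

lemma occurrencesI:
  assumes "\<And>i j. \<lbrakk>1 \<le> i; i < j; j \<le> length p\<rbrakk> \<Longrightarrow> f i < f j"
    and "\<And>j. j \<in> {1..length p} \<Longrightarrow> f j \<in> {1..length w} \<and> letter w (f j) = letter p j"
  shows "map f [Suc 0..<Suc (length p)] \<in> occurrences p w"
proof -
  have "map (letter w) (map f [Suc 0..<Suc (length p)]) = p"
    using assms(2) by (intro nth_equalityI) (auto simp: letter_def simp del: upt_Suc)
  then show ?thesis
    using assms unfolding occurrences_def
    by (auto simp: sorted_wrt_iff_nth_less image_subset_iff simp del: upt_Suc)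
qed

lemma occurrencesD:
  assumes "is \<in> occurrences p w"
  shows "length is = length p"
    and "\<And>j. j \<in> {1..length p} \<Longrightarrow> letter is j \<in> {1..length w}"
    and "\<And>j. j \<in> {1..length p} \<Longrightarrow> letter w (letter is j) = letter p j"
    and "\<And>i j. \<lbrakk>1 \<le> i; i < j; j \<le> length p\<rbrakk> \<Longrightarrow> letter is i < letter is j"
proof -
  have props: "map (letter w) is = p" "sorted_wrt (<) is" "set is \<subseteq> {1..length w}"
    using assms by (auto simp: occurrences_def)
  show len: "length is = length p"
    using arg_cong[OF props(1), of length] by simp
  show "letter is j \<in> {1..length w}" if "j \<in> {1..length p}" for j
  proof -
    have "letter is j \<in> set is"
      using that len by (auto simp: set_eq_letters)
    then show ?thesis
      using props(3) by blast
  qed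
  show "letter is i < letter is j" if "1 \<le> i" "i < j" "j \<le> length p" for i j
    using props(2) that len by (simp add: letter_def sorted_wrt_iff_nth_less)
  show "letter w (letter is j) = letter p j" if "j \<in> {1..length p}" for j
  proof -
    have "map (letter w) is ! (j - 1) = p ! (j - 1)"
      using props(1) by simp
    then show ?thesis
      using that len by (auto simp: letter_def)
  qed
qed

lemma occurrences_le:
  assumes "is \<in> occurrences p w" "1 \<le> i" "i \<le> j" "j \<le> length p"
  shows "letter is i \<le> letter is j"
  using occurrencesD(4)[OF assms(1,2), of j] assms by (cases "i = j") auto

lemma occurrence_eqI:
  assumes "is \<in> occurrences p w" "is' \<in> occurrences p w"
    and "\<And>j. j \<in> {1..length p} \<Longrightarrow> letter is j = letter is' j"
  shows "is = is'"
proof (rule nth_equalityI)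
  show "length is = length is'"
    using assms by (simp add: occurrencesD(1))
  fix i assume "i < length is"
  then show "is ! i = is' ! i"
    using assms(3)[of "Suc i"] assms by (simp add: letter_def occurrencesD(1))
qed

text \<open>Positions before \<open>j\<close> follow \<open>is\<close>, positions after it follow
  \<open>is'\<close>. The index \<open>t\<close> separates the two parts, so the combined tuple is
  increasing. With \<open>is = is'\<close> this moves a single letter of an occurrence.\<close>

lemma splice_occurrences:
  assumes "is \<in> occurrences p w" "is' \<in> occurrences p w"
    and "j \<in> {1..length p}" "t \<in> {1..length w}" "letter w t = letter p j"
    and "\<And>i. \<lbrakk>1 \<le> i; i < j\<rbrakk> \<Longrightarrow> letter is i < t"
    and "\<And>i. \<lbrakk>j < i; i \<le> length p\<rbrakk> \<Longrightarrow> t < letter is' i"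
  shows "\<exists>js\<in>occurrences p w. letter js j = t"
proof -
  let ?f = "\<lambda>i. if i < j then letter is i else if i = j then t else letter is' i"
  have "map ?f [Suc 0..<Suc (length p)] \<in> occurrences p w"
  proof (rule occurrencesI)
    fix a b assume ab: "1 \<le> a" "a < b" "b \<le> length p"
    have "letter is a < letter is' b" if "a < j" "j < b"
      using assms(6)[of a] assms(7)[of b] that ab by simp
    then show "?f a < ?f b"
      using assms(6)[of a] assms(7)[of b] ab occurrencesD(4)[OF assms(1) ab]
        occurrencesD(4)[OF assms(2) ab] by auto
  next
    fix i assume "i \<in> {1..length p}"
    then show "?f i \<in> {1..length w} \<and> letter w (?f i) = letter p i"
      using assms(4,5) occurrencesD(2,3)[OF assms(1)] occurrencesD(2,3)[OF assms(2)] by auto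
  qed
  moreover have "letter (map ?f [Suc 0..<Suc (length p)]) j = t"
    using assms(3) by (simp only: letter_map_upt) simp
  ultimately show ?thesis
    by blast
qed

section \<open>Extremal occurrences and the gaps between their letters\<close>

lemma finite_occurrences: "finite (occurrences p w)"
proof (rule finite_subset)
  show "occurrences p w \<subseteq> {is. set is \<subseteq> {1..length w} \<and> length is = length p}"
    by (auto simp: occurrences_def)
qed (simp add: finite_lists_length_eq)

text \<open>The positionwise minimum \<open>f\<close> of all occurrences is itself an occurrence: if
  \<open>is\<close> attains the minimum at \<open>j\<close> and \<open>i < j\<close>, then
  \<open>f i\<close> \<le> \<open>letter is i\<close> < \<open>letter is j\<close> =
  \<open>f j\<close>. Hence the description defining \<open>lexmin\<close> is satisfied, and
  uniquely so by antisymmetry.\<close>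

lemma lexmin_properties:
  assumes "occurrences p w \<noteq> {}"
  shows "lexmin p w \<in> occurrences p w"
    and "\<And>is j. \<lbrakk>is \<in> occurrences p w; j \<in> {1..length p}\<rbrakk> \<Longrightarrow> letter (lexmin p w) j \<le> letter is j"
proof -
  let ?P = "\<lambda>is. is \<in> occurrences p w \<and>
     (\<forall>is'\<in>occurrences p w. \<forall>j\<in>{1..length p}. letter is j \<le> letter is' j)"
  define f where "f j = Min ((\<lambda>is. letter is j) ` occurrences p w)" for j
  have le: "f j \<le> letter is j" if "is \<in> occurrences p w" for "is" j
    unfolding f_def using that finite_occurrences by (intro Min_le) auto
  have att: "\<exists>is\<in>occurrences p w. f j = letter is j" for j
  proof -
    have "f j \<in> (\<lambda>is. letter is j) ` occurrences p w"
      unfolding f_def using assms finite_occurrences by (intro Min_in) auto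
    then show ?thesis
      by auto
  qed
  have occ: "map f [Suc 0..<Suc (length p)] \<in> occurrences p w"
  proof (rule occurrencesI)
    fix i j assume ij: "1 \<le> i" "i < j" "j \<le> length p"
    obtain "is" where "is \<in> occurrences p w" "f j = letter is j"
      using att by blast
    then show "f i < f j"
      using le[of "is" i] occurrencesD(4)[of "is", OF _ ij] by fastforce
  next
    fix j assume "j \<in> {1..length p}"
    then show "f j \<in> {1..length w} \<and> letter w (f j) = letter p j"
      using att[of j] occurrencesD(2,3) by metis
  qed
  have "?P (lexmin p w)"
    unfolding lexmin_def
  proof (rule theI)
    show "?P (map f [Suc 0..<Suc (length p)])"
      using occ le by (auto simp: letter_map_upt simp del: upt_Suc)
    then show "is = map f [Suc 0..<Suc (length p)]" if "?P is" for "is"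
      using that by (intro occurrence_eqI[of _ p w]) (auto intro!: antisym simp del: upt_Suc)
  qed
  then show "lexmin p w \<in> occurrences p w"
    and "\<And>is j. \<lbrakk>is \<in> occurrences p w; j \<in> {1..length p}\<rbrakk> \<Longrightarrow> letter (lexmin p w) j \<le> letter is j"
    by auto
qed

text \<open>Dually, the positionwise maximum is an occurrence; for \<open>i < j\<close> the witness
  is now an occurrence attaining the maximum at the smaller position \<open>i\<close>.\<close>

lemma lexmax_properties:
  assumes "occurrences p w \<noteq> {}"
  shows "lexmax p w \<in> occurrences p w"
    and "\<And>is j. \<lbrakk>is \<in> occurrences p w; j \<in> {1..length p}\<rbrakk> \<Longrightarrow> letter is j \<le> letter (lexmax p w) j"
proof -
  let ?P = "\<lambda>is. is \<in> occurrences p w \<and>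
     (\<forall>is'\<in>occurrences p w. \<forall>j\<in>{1..length p}. letter is' j \<le> letter is j)"
  define f where "f j = Max ((\<lambda>is. letter is j) ` occurrences p w)" for j
  have le: "letter is j \<le> f j" if "is \<in> occurrences p w" for "is" j
    unfolding f_def using that finite_occurrences by (intro Max_ge) auto
  have att: "\<exists>is\<in>occurrences p w. f j = letter is j" for j
  proof -
    have "f j \<in> (\<lambda>is. letter is j) ` occurrences p w"
      unfolding f_def using assms finite_occurrences by (intro Max_in) auto
    then show ?thesis
      by auto
  qed
  have occ: "map f [Suc 0..<Suc (length p)] \<in> occurrences p w"
  proof (rule occurrencesI)
    fix i j assume ij: "1 \<le> i" "i < j" "j \<le> length p"
    obtain "is" where "is \<in> occurrences p w" "f i = letter is i"
      using att by blast
    then show "f i < f j"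
      using le[of "is" j] occurrencesD(4)[of "is", OF _ ij] by fastforce
  next
    fix j assume "j \<in> {1..length p}"
    then show "f j \<in> {1..length w} \<and> letter w (f j) = letter p j"
      using att[of j] occurrencesD(2,3) by metis
  qed
  have "?P (lexmax p w)"
    unfolding lexmax_def
  proof (rule theI)
    show "?P (map f [Suc 0..<Suc (length p)])"
      using occ le by (auto simp: letter_map_upt simp del: upt_Suc)
    then show "is = map f [Suc 0..<Suc (length p)]" if "?P is" for "is"
      using that by (intro occurrence_eqI[of _ p w]) (auto intro!: antisym simp del: upt_Suc)
  qed
  then show "lexmax p w \<in> occurrences p w"
    and "\<And>is j. \<lbrakk>is \<in> occurrences p w; j \<in> {1..length p}\<rbrakk> \<Longrightarrow> letter is j \<le> letter (lexmax p w) j"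
    by auto
qed

text \<open>Otherwise splicing \<open>t\<close> into the minimal occurrence itself at position
  \<open>j\<close> would give an occurrence whose \<open>j\<close>th index is smaller. For
  \<open>j = 1\<close> there is no preceding letter, hence the guard \<open>1 < j\<close>.\<close>

lemma lexmin_gap:
  assumes "occurrences p w \<noteq> {}" "j \<in> {1..length p}"
    and "1 \<le> t" "1 < j \<Longrightarrow> letter (lexmin p w) (j - 1) < t" "t < letter (lexmin p w) j"
  shows "letter w t \<noteq> letter p j"
proof
  assume eq: "letter w t = letter p j"
  note L = lexmin_properties[OF assms(1)]
  have "\<exists>js\<in>occurrences p w. letter js j = t"
  proof (rule splice_occurrences[OF L(1) L(1) assms(2) _ eq])
    show "t \<in> {1..length w}"
      using assms(3,5) occurrencesD(2)[OF L(1) assms(2)] by auto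
    show "letter (lexmin p w) i < t" if "1 \<le> i" "i < j" for i
    proof -
      have "letter (lexmin p w) i \<le> letter (lexmin p w) (j - 1)"
        using that assms(2) by (intro occurrences_le[OF L(1)]) auto
      then show ?thesis
        using that assms(4) by simp
    qed
    show "t < letter (lexmin p w) i" if "j < i" "i \<le> length p" for i
      using occurrences_le[OF L(1), of j i] that assms(2,5) by auto
  qed
  then show False
    using L(2)[OF _ assms(2)] assms(5) by force
qed

text \<open>Otherwise the \<open>j\<close>th letter of the maximal occurrence could be moved right
  to \<open>t\<close>. The guard \<open>j < length p\<close> covers the last position, which has no
  successor.\<close>

lemma lexmax_gap:
  assumes "occurrences p w \<noteq> {}" "j \<in> {1..length p}"
    and "t \<le> length w" "letter (lexmax p w) j < t"
    and "j < length p \<Longrightarrow> t < letter (lexmax p w) (j + 1)"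
  shows "letter w t \<noteq> letter p j"
proof
  assume eq: "letter w t = letter p j"
  note R = lexmax_properties[OF assms(1)]
  have "\<exists>js\<in>occurrences p w. letter js j = t"
  proof (rule splice_occurrences[OF R(1) R(1) assms(2) _ eq])
    show "t \<in> {1..length w}"
      using assms(3,4) occurrencesD(2)[OF R(1) assms(2)] by auto
    show "letter (lexmax p w) i < t" if "1 \<le> i" "i < j" for i
      using occurrences_le[OF R(1), of i j] that assms(2,4) by auto
    show "t < letter (lexmax p w) i" if "j < i" "i \<le> length p" for i
      using occurrences_le[OF R(1), of "j + 1" i] that assms(2,5) by auto
  qed
  then show False
    using R(2)[OF _ assms(2)] assms(4) by force
qed

text \<open>An index between the first and the last one of the block is either used by the
  occurrence or lies strictly between two consecutive used indices, where \<open>gap\<close>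
  excludes the letter \<open>x\<close>. The count follows since indices increase with
  positions.\<close>

lemma letters_between_gapless:
  assumes occ: "is \<in> occurrences p w" and ab: "1 \<le> a" "a \<le> b" "b \<le> length p"
    and const: "\<And>j. j \<in> {a..b} \<Longrightarrow> letter p j = x"
    and gap: "\<And>j t. \<lbrakk>a \<le> j; j < b; letter is j < t; t < letter is (Suc j)\<rbrakk> \<Longrightarrow> letter w t \<noteq> x"
  shows "{t \<in> {letter is a..letter is b}. letter w t = x} = letter is ` {a..b}"
    and "card {t \<in> {letter is a..letter is b}. letter w t = x} = Suc b - a"
proof -
  show eq: "{t \<in> {letter is a..letter is b}. letter w t = x} = letter is ` {a..b}"
  proof (intro equalityI subsetI)
    fix t assume t: "t \<in> {t \<in> {letter is a..letter is b}. letter w t = x}"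
    \<comment> \<open>The last position of the block whose index is at most \<open>t\<close>: unless
      that index is \<open>t\<close>, it and its successor enclose \<open>t\<close> in a
      gap.\<close>
    define j where "j = Max {j \<in> {a..b}. letter is j \<le> t}"
    have fin: "finite {j \<in> {a..b}. letter is j \<le> t}"
      by simp
    have j: "j \<in> {j \<in> {a..b}. letter is j \<le> t}"
      unfolding j_def by (rule Max_in) (use t ab in auto)
    show "t \<in> letter is ` {a..b}"
    proof (cases "letter is j = t")
      case False
      then have lt: "letter is j < t"
        using j by auto
      then have "j < b"
        using j t by (auto simp: less_le)
      then have "\<not> letter is (Suc j) \<le> t"
        using Max_ge[OF fin, of "Suc j"] j unfolding j_def[symmetric] by auto
      then show ?thesis
        using gap[of j t] lt j t \<open>j < b\<close> by auto
    qed (use j in auto)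
  next
    fix t assume "t \<in> letter is ` {a..b}"
    then obtain j where j: "j \<in> {a..b}" "t = letter is j"
      by auto
    then show "t \<in> {t \<in> {letter is a..letter is b}. letter w t = x}"
      using occurrences_le[OF occ, of a j] occurrences_le[OF occ, of j b]
        occurrencesD(3)[OF occ, of j] const[of j] ab by auto
  qed
  have "strict_mono_on {a..b} (letter is)"
    using ab by (intro strict_mono_onI occurrencesD(4)[OF occ]) auto
  then have "inj_on (letter is) {a..b}"
    by (rule strict_mono_on_imp_inj_on)
  then show "card {t \<in> {letter is a..letter is b}. letter w t = x} = Suc b - a"
    unfolding eq by (simp add: card_image)
qed

text \<open>The count grows strictly with each further letter equal to \<open>letter w j\<close>, so
  among the indices of such letters it determines \<open>i\<close>. This gives the uniqueness that
  the definite description needs.\<close>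

lemma Rlet_eqI:
  assumes "i \<in> {j..length w}" "letter w i = letter w j"
    and "card {t \<in> {j..i}. letter w t = letter w j} = k"
  shows "Rlet w j k = i"
proof -
  have less: "card {t \<in> {j..a}. letter w t = letter w j} < card {t \<in> {j..b}. letter w t = letter w j}"
    if "j \<le> a" "a < b" "letter w b = letter w j" for a b
  proof (rule psubset_card_mono)
    have "b \<in> {t \<in> {j..b}. letter w t = letter w j} - {t \<in> {j..a}. letter w t = letter w j}"
      using that by auto
    then show "{t \<in> {j..a}. letter w t = letter w j} \<subset> {t \<in> {j..b}. letter w t = letter w j}"
      using that by fastforce
  qed simp
  show ?thesis
    unfolding Rlet_def
  proof (rule the_equality)
    fix a assume a: "a \<in> {j..length w} \<and> letter w a = letter w j \<and>
      card {t \<in> {j..a}. letter w t = letter w j} = k"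
    show "a = i"
      using less[of a i] less[of i a] a assms by (cases a i rule: linorder_cases) auto
  qed (use assms in auto)
qed

lemma Llet_eqI:
  assumes "i \<in> {1..j}" "letter w i = letter w j"
    and "card {t \<in> {i..j}. letter w t = letter w j} = k"
  shows "Llet w j k = i"
proof -
  have less: "card {t \<in> {b..j}. letter w t = letter w j} < card {t \<in> {a..j}. letter w t = letter w j}"
    if "b \<le> j" "a < b" "letter w a = letter w j" for a b
  proof (rule psubset_card_mono)
    have "a \<in> {t \<in> {a..j}. letter w t = letter w j} - {t \<in> {b..j}. letter w t = letter w j}"
      using that by auto
    then show "{t \<in> {b..j}. letter w t = letter w j} \<subset> {t \<in> {a..j}. letter w t = letter w j}"
      using that by fastforce
  qed simp
  show ?thesis
    unfolding Llet_def
  proof (rule the_equality)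
    fix a assume a: "a \<in> {1..j} \<and> letter w a = letter w j \<and>
      card {t \<in> {a..j}. letter w t = letter w j} = k"
    show "a = i"
      using less[of a i] less[of i a] a assms by (cases a i rule: linorder_cases) auto
  qed (use assms in auto)
qed


section \<open>Runs inside the extremal occurrences\<close>

text \<open>As \<open>p\<close> is constant on its \<open>k\<close>th run, \<open>lexmin_gap\<close>
  at the right end of each gap inside the block keeps that letter out of the gap.\<close>

lemma letters_between_lexmin:
  assumes occ: "occurrences p w \<noteq> {}" and k: "k \<in> {1..num_runs p}"
  defines "L \<equiv> letter (lexmin p w)"
  shows "{t \<in> {L (phi p k)..L (psi p k)}. letter w t = hd (run p k)} = L ` {phi p k..psi p k}"
    and "card {t \<in> {L (phi p k)..L (psi p k)}. letter w t = hd (run p k)} = length (run p k)"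
proof -
  have gap: "letter w t \<noteq> hd (run p k)"
    if "phi p k \<le> j" "j < psi p k" "letter (lexmin p w) j < t" "t < letter (lexmin p w) (Suc j)"
    for j t
    using lexmin_gap[OF occ, of "Suc j" t] letter_run[OF k, of "Suc j"] that phi_psi_bounds[OF k]
    by simp
  note between = letters_between_gapless[OF lexmin_properties(1)[OF occ] phi_psi_bounds[OF k]
    letter_run[OF k] gap]
  show "{t \<in> {L (phi p k)..L (psi p k)}. letter w t = hd (run p k)} = L ` {phi p k..psi p k}"
    unfolding L_def by (rule between(1))
  show "card {t \<in> {L (phi p k)..L (psi p k)}. letter w t = hd (run p k)} = length (run p k)"
    unfolding L_def using between(2) psi_eq_phi[OF k] by simp
qed

text \<open>Dual to the minimal case, but \<open>lexmax_gap\<close> is applied at the left end of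
  each gap, since here it is the left letter that could be moved into the gap.\<close>

lemma letters_between_lexmax:
  assumes occ: "occurrences p w \<noteq> {}" and k: "k \<in> {1..num_runs p}"
  defines "R \<equiv> letter (lexmax p w)"
  shows "{t \<in> {R (phi p k)..R (psi p k)}. letter w t = hd (run p k)} = R ` {phi p k..psi p k}"
    and "card {t \<in> {R (phi p k)..R (psi p k)}. letter w t = hd (run p k)} = length (run p k)"
proof -
  note max_occ = lexmax_properties(1)[OF occ]
  have gap: "letter w t \<noteq> hd (run p k)"
    if "phi p k \<le> j" "j < psi p k" "letter (lexmax p w) j < t" "t < letter (lexmax p w) (Suc j)"
    for j t
    using lexmax_gap[OF occ, of j t] letter_run[OF k, of j] that phi_psi_bounds[OF k]
      occurrencesD(2)[OF max_occ, of "Suc j"] by simp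
  note between = letters_between_gapless[OF max_occ phi_psi_bounds[OF k] letter_run[OF k] gap]
  show "{t \<in> {R (phi p k)..R (psi p k)}. letter w t = hd (run p k)} = R ` {phi p k..psi p k}"
    unfolding R_def by (rule between(1))
  show "card {t \<in> {R (phi p k)..R (psi p k)}. letter w t = hd (run p k)} = length (run p k)"
    unfolding R_def using between(2) psi_eq_phi[OF k] by simp
qed

section \<open>The head runs of the minimal occurrence\<close>

lemma run_eqI:
  assumes "t \<in> {phi u i..psi u i}" "t \<in> {phi u j..psi u j}"
  shows "i = j"
  using assms psi_less_phi[of i j u] psi_less_phi[of j i u]
  by (cases i j rule: linorder_cases) auto

lemma letter_pred_phi:
  assumes "k \<in> {1..num_runs p}" "1 < phi p k"
  shows "k - 1 \<in> {1..num_runs p}" "phi p k - 1 = psi p (k - 1)"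
    "letter p (phi p k - 1) \<noteq> letter p (phi p k)"
proof -
  obtain i where i: "k = Suc i"
    using assms by (cases k) auto
  then have "i \<noteq> 0"
    using assms(2) by (cases i) (auto simp: phi_Suc)
  then show "k - 1 \<in> {1..num_runs p}" "phi p k - 1 = psi p (k - 1)"
    "letter p (phi p k - 1) \<noteq> letter p (phi p k)"
    using i assms letter_psi_Suc[of i p] by (auto simp: phi_Suc)
qed

text \<open>If the block began inside a run of \<open>w\<close>, the index just before it would
  carry the same letter and could replace it, against minimality.\<close>

lemma phi_head:
  assumes occ: "occurrences p w \<noteq> {}" and k: "k \<in> {1..num_runs p}"
  shows "phi w (head p w k) = letter (lexmin p w) (phi p k)"
proof -
  let ?L = "letter (lexmin p w)" and ?a = "phi p k"
  note min_occ = lexmin_properties(1)[OF occ]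
  have a: "?a \<in> {1..length p}"
    using phi_psi_bounds[OF k] by auto
  obtain c where c: "c \<in> {1..num_runs w}" "?L ?a \<in> {phi w c..psi w c}"
    using ex_run occurrencesD(2)[OF min_occ a] by blast
  have "head p w k = c"
    unfolding head_def using c run_eqI by (intro the_equality) blast+
  moreover have "phi w c = ?L ?a"
  proof (rule ccontr)
    assume "phi w c \<noteq> ?L ?a"
    then have t: "?L ?a - 1 \<in> {phi w c..psi w c}" "1 \<le> ?L ?a - 1"
      using c phi_psi_bounds[OF c(1)] by auto
    have same: "letter w (?L ?a - 1) = letter p ?a"
      using letter_run[OF c(1) t(1)] letter_run[OF c(1) c(2)] occurrencesD(3)[OF min_occ a] by simp
    \<comment> \<open>The preceding letter of the minimal occurrence cannot sit at the replacement
      index, because it belongs to the previous run of \<open>p\<close> and has the other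
      parity.\<close>
    have "?L (?a - 1) < ?L ?a - 1" if "1 < ?a"
    proof -
      have "?L (?a - 1) \<noteq> ?L ?a - 1"
        using same letter_pred_phi(3)[OF k that] occurrencesD(3)[OF min_occ, of "?a - 1"] a that
        by fastforce
      moreover have "?L (?a - 1) < ?L ?a"
        using occurrencesD(4)[OF min_occ, of "?a - 1" ?a] a that by simp
      ultimately show ?thesis
        by simp
    qed
    then show False
      using lexmin_gap[OF occ a, of "?L ?a - 1"] same t by simp
  qed
  ultimately show ?thesis
    by simp
qed

text \<open>This identifies the \<open>Rlet\<close> term with the end of the \<open>k\<close>th
  block: the block starts at the head run and its length counts all letters of its parity up to
  there.\<close>

lemma Rlet_head:
  assumes occ: "occurrences p w \<noteq> {}" and k: "k \<in> {1..num_runs p}"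
  shows "Rlet w (phi w (head p w k)) (length (run p k)) = letter (lexmin p w) (psi p k)"
proof (rule Rlet_eqI)
  note min_occ = lexmin_properties(1)[OF occ]
  note b = phi_psi_bounds[OF k]
  have letters: "letter w (letter (lexmin p w) (phi p k)) = hd (run p k)"
    "letter w (letter (lexmin p w) (psi p k)) = hd (run p k)"
    using occurrencesD(3)[OF min_occ] letter_run[OF k] b by simp_all
  show "letter (lexmin p w) (psi p k) \<in> {phi w (head p w k)..length w}"
    using occurrences_le[OF min_occ b] occurrencesD(2)[OF min_occ, of "psi p k"] b
    by (simp add: phi_head[OF occ k])
  show "letter w (letter (lexmin p w) (psi p k)) = letter w (phi w (head p w k))"
    using letters by (simp add: phi_head[OF occ k])
  show "card {t \<in> {phi w (head p w k)..letter (lexmin p w) (psi p k)}.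
      letter w t = letter w (phi w (head p w k))} = length (run p k)"
    using letters_between_lexmin(2)[OF occ k] letters by (simp add: phi_head[OF occ k])
qed

section \<open>The run indices of the maximal occurrence\<close>

lemma lambda_eqI:
  assumes "2 * k < i" "sigma w (i - 2 * k) i \<ge> j"
    and "\<And>k'. k' < k \<Longrightarrow> sigma w (i - 2 * k') i < j"
  shows "lambda w i j = k"
  unfolding lambda_def
proof (rule Least_equality)
  show "k \<le> y" if "2 * y < i \<and> j \<le> sigma w (i - 2 * y) i" for y
    using that assms(3)[of y] by (cases "y < k") auto
qed (use assms in simp)

lemma letter_phi_psi:
  assumes "k \<in> {1..num_runs p}"
  shows "letter p (phi p k) = hd (run p k)" "letter p (psi p k) = hd (run p k)"
  using assms phi_psi_bounds[of k p] by (auto intro!: letter_run)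

text \<open>\<open>zeta\<close> is the last run of \<open>w\<close> with the parity of the last run
  of \<open>p\<close>. If the maximal occurrence ended before the end of that run, its last letter
  could be moved there.\<close>

lemma psi_zeta:
  assumes occ: "occurrences p w \<noteq> {}" and p: "1 \<le> num_runs p"
  shows "zeta p w \<in> {1..num_runs w}" "psi w (zeta p w) = letter (lexmax p w) (length p)"
proof -
  let ?r = "num_runs p" and ?s = "num_runs w" and ?z = "zeta p w"
  let ?R = "letter (lexmax p w)"
  note max_occ = lexmax_properties(1)[OF occ]
  have r: "?r \<in> {1..?r}"
    using p by simp
  have m: "length p \<in> {1..length p}"
    using phi_psi_bounds[OF r] by (simp add: psi_num_runs)
  have last: "letter p (length p) = hd (run p ?r)"
    using letter_phi_psi(2)[OF r] by (simp add: psi_num_runs)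
  obtain c where c: "c \<in> {1..?s}" "?R (length p) \<in> {phi w c..psi w c}"
    using ex_run occurrencesD(2)[OF max_occ m] by blast
  have hc: "hd (run w c) = hd (run p ?r)"
    using letter_run[OF c] occurrencesD(3)[OF max_occ m] last by simp
  have z: "?z \<in> {1..?s} \<and> hd (run w ?z) = hd (run p ?r)"
  proof (cases "hd (run p ?r) = hd (run w ?s)")
    case True
    then show ?thesis
      using c by (auto simp: zeta_def parity_def)
  next
    case False
    \<comment> \<open>Since the last letter of the occurrence lies in a run \<open>c\<close> other
      than the last one, \<open>num_runs w - 1\<close> is a genuine run index.\<close>
    then have "c \<noteq> ?s"
      using hc by auto
    then have "2 \<le> ?s"
      using c by auto
    then show ?thesis
      using False hd_run_Suc[of "?s - 1" w] by (auto simp: zeta_def parity_def)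
  qed
  then show "?z \<in> {1..?s}"
    by simp
  \<comment> \<open>At most one run follows \<open>zeta\<close>, so a run \<open>c\<close> beyond it
    would be its neighbour, which has the wrong parity.\<close>
  have "?s \<le> Suc ?z"
    by (auto simp: zeta_def)
  have cz: "c \<le> ?z"
  proof (rule ccontr)
    assume "\<not> c \<le> ?z"
    then have "c = Suc ?z"
      using c \<open>?s \<le> Suc ?z\<close> by auto
    then show False
      using hd_run_Suc[of ?z w] z c hc by auto
  qed
  show "psi w ?z = ?R (length p)"
  proof (rule ccontr)
    assume neq: "psi w ?z \<noteq> ?R (length p)"
    have "?R (length p) < psi w ?z"
      using neq c psi_mono[OF cz, of w] by auto
    moreover have "letter w (psi w ?z) = letter p (length p)"
      using letter_phi_psi(2)[of ?z w] z last by simp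
    ultimately show False
      using lexmax_gap[OF occ m, of "psi w ?z"] phi_psi_bounds[of ?z w] z by auto
  qed
qed

text \<open>Let \<open>d\<close> be the run of \<open>w\<close> in which the block of run
  \<open>Suc k\<close> of \<open>p\<close> begins. Going back from \<open>c\<close>, the runs of its
  parity first contain \<open>length (run p (Suc k))\<close> letters when \<open>d\<close> is
  reached, so \<open>lambda\<close> is half of \<open>c - d\<close> and \<open>c'\<close> is
  \<open>d - 1\<close>. The previous block then ends exactly at the end of run
  \<open>d - 1\<close>.\<close>

lemma psi_lambda_step:
  fixes p w :: "bool list"
  assumes occ: "occurrences p w \<noteq> {}" and k: "1 \<le> k" "Suc k \<le> num_runs p"
    and c: "c \<in> {1..num_runs w}" "psi w c = letter (lexmax p w) (psi p (Suc k))"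
  defines "c' \<equiv> c - 2 * lambda w c (length (run p (Suc k))) - 1"
  shows "c' \<in> {1..num_runs w}" "psi w c' = letter (lexmax p w) (psi p k)"
proof -
  let ?R = "letter (lexmax p w)" and ?x = "hd (run p (Suc k))" and ?n = "length (run p (Suc k))"
  let ?a = "phi p (Suc k)" and ?b = "psi p (Suc k)"
  note max_occ = lexmax_properties(1)[OF occ]
  have Sk: "Suc k \<in> {1..num_runs p}" and k': "k \<in> {1..num_runs p}"
    using k by auto
  note b = phi_psi_bounds[OF Sk]
  have a_pos: "?a \<in> {1..length p}" and k_pos: "psi p k \<in> {1..length p}" "Suc (psi p k) = ?a"
    using b phi_psi_bounds[OF k'] by (auto simp: phi_Suc)
  obtain d where d: "d \<in> {1..num_runs w}" "?R ?a \<in> {phi w d..psi w d}"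
    using ex_run occurrencesD(2)[OF max_occ a_pos] by blast
  have hd_d: "hd (run w d) = ?x"
    using letter_run[OF d] occurrencesD(3)[OF max_occ a_pos] letter_phi_psi(1)[OF Sk] by simp
  have hd_c: "hd (run w c) = ?x"
    using letter_phi_psi(2)[OF c(1)] occurrencesD(3)[OF max_occ, of ?b] letter_phi_psi(2)[OF Sk]
      b c(2) by simp
  have ab: "?R ?a \<le> ?R ?b"
    using occurrences_le[OF max_occ b] .
  have "d \<le> c"
    using psi_less_phi[of c d w] d c ab by (auto simp: not_le[symmetric])
  have "even (c - d)"
    using hd_run_add[of d "c - d" w] d c \<open>d \<le> c\<close> hd_c hd_d by auto
  \<comment> \<open>Both ends of the block carry the same letter, so their runs lie an even distance
    apart.\<close>
  then obtain q where q: "c = d + 2 * q"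
    using \<open>d \<le> c\<close> by (metis dvd_def le_add_diff_inverse)
  have sigma: "sigma w (c - 2 * i) c = card {t \<in> {phi w (c - 2 * i)..?R ?b}. letter w t = ?x}"
    if "i \<le> q" for i
  proof -
    have e: "c = (c - 2 * i) + 2 * i" "1 \<le> c - 2 * i"
      using that q d by auto
    have "hd (run w (c - 2 * i)) = ?x"
      using hd_run_add[of "c - 2 * i" "2 * i" w] e hd_c c(1) by simp
    then show ?thesis
      using sigma_eq_card[of "c - 2 * i" i w] e c by simp
  qed
  note card_R = letters_between_lexmax(2)[OF occ Sk]
  have "lambda w c ?n = q"
  proof (rule lambda_eqI)
    show "2 * q < c"
      using q d by auto
    have "phi w (c - 2 * q) \<le> ?R ?a"
      using d q by auto
    then have "?n \<le> card {t \<in> {phi w (c - 2 * q)..?R ?b}. letter w t = ?x}"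
      unfolding card_R[symmetric] by (intro card_mono) auto
    then show "?n \<le> sigma w (c - 2 * q) c"
      by (simp add: sigma)
    fix i assume i: "i < q"
    \<comment> \<open>Stopping earlier misses at least the first letter of the block, so the count
      stays strictly below the length of the run of \<open>p\<close>.\<close>
    have "d < c - 2 * i"
      using q i by arith
    then have "?R ?a < phi w (c - 2 * i)"
      using psi_less_phi[of d "c - 2 * i" w] d by auto
    moreover have "letter w (?R ?a) = ?x"
      using occurrencesD(3)[OF max_occ a_pos] letter_phi_psi(1)[OF Sk] by simp
    ultimately have "?R ?a \<in> {t \<in> {?R ?a..?R ?b}. letter w t = ?x} -
          {t \<in> {phi w (c - 2 * i)..?R ?b}. letter w t = ?x}"
      and "{t \<in> {phi w (c - 2 * i)..?R ?b}. letter w t = ?x} \<subseteq>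
          {t \<in> {?R ?a..?R ?b}. letter w t = ?x}"
      using ab by auto
    then have "{t \<in> {phi w (c - 2 * i)..?R ?b}. letter w t = ?x} \<subset>
        {t \<in> {?R ?a..?R ?b}. letter w t = ?x}"
      by blast
    then have "card {t \<in> {phi w (c - 2 * i)..?R ?b}. letter w t = ?x} < ?n"
      unfolding card_R[symmetric] by (intro psubset_card_mono) auto
    then show "sigma w (c - 2 * i) c < ?n"
      using i by (simp add: sigma)
  qed
  then have c'_eq: "c' = d - 1"
    by (simp add: c'_def q)
  have kR: "letter w (?R (psi p k)) = hd (run p k)" "?R (psi p k) \<in> {1..length w}"
    using occurrencesD(2,3)[OF max_occ k_pos(1)] letter_phi_psi(2)[OF k'] by auto
  have hd_k: "hd (run p k) \<noteq> ?x"
    using hd_run_Suc[of k p] k by simp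
  have lt: "?R (psi p k) < ?R ?a"
    using occurrencesD(4)[OF max_occ, of "psi p k" ?a] k_pos a_pos by auto
  \<comment> \<open>Run \<open>d\<close> has the parity of run \<open>Suc k\<close> of
    \<open>p\<close>, so the last letter of the preceding block lies before it.\<close>
  have lt_d: "?R (psi p k) < phi w d"
  proof (rule ccontr)
    assume "\<not> ?R (psi p k) < phi w d"
    then have "letter w (?R (psi p k)) = hd (run w d)"
      using lt d by (intro letter_run[OF d(1)]) auto
    then show False
      using kR hd_k hd_d by simp
  qed
  \<comment> \<open>Indices of letters are positive, so something precedes run \<open>d\<close>;
    hence the subtraction in \<open>d - 1\<close> yields a genuine run index.\<close>
  then have "d \<noteq> 1"
    using kR by (auto simp: phi_def)
  then have d': "d - 1 \<in> {1..num_runs w}" "phi w d = Suc (psi w (d - 1))"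
    using d phi_Suc[of w "d - 1"] by auto
  then show "c' \<in> {1..num_runs w}"
    by (simp add: c'_eq)
  have "hd (run w (d - 1)) \<noteq> ?x"
    using hd_run_Suc[of "d - 1" w] d(1) d'(1) hd_d by (cases d) auto
  then have "letter w (psi w (d - 1)) = letter p (psi p k)"
    using letter_phi_psi(2)[OF d'(1)] letter_phi_psi(2)[OF k'] hd_k by auto
  \<comment> \<open>The end of run \<open>d - 1\<close> carries the required letter and precedes the
    next block, so by \<open>lexmax_gap\<close> the letter at position \<open>psi p k\<close> cannot
    lie left of it.\<close>
  then have "\<not> ?R (psi p k) < psi w (d - 1)"
    using lexmax_gap[OF occ k_pos(1), of "psi w (d - 1)"] phi_psi_bounds[OF d'(1)] d d' k_pos
    by auto
  then show "psi w c' = ?R (psi p k)"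
    using lt_d d' by (simp add: c'_eq)
qed

text \<open>\<open>maxrun\<close> numbers the runs of \<open>p\<close> from the right, so its index
  \<open>Suc i\<close> corresponds to run \<open>num_runs p - i\<close>.\<close>

lemma psi_maxrun:
  assumes occ: "occurrences p w \<noteq> {}" and "Suc i \<le> num_runs p"
  shows "maxrun p w (Suc i) \<in> {1..num_runs w} \<and>
    psi w (maxrun p w (Suc i)) = letter (lexmax p w) (psi p (num_runs p - i))"
  using assms(2)
proof (induction i)
  case 0
  then show ?case
    using psi_zeta[OF occ] by (simp add: psi_num_runs)
next
  case (Suc i)
  define k where "k = num_runs p - Suc i"
  have k: "1 \<le> k" "num_runs p - i = Suc k" "num_runs p - Suc i + 1 = Suc k"
    using Suc.prems by (auto simp: k_def)
  show ?case
    using psi_lambda_step[OF occ k(1), of "maxrun p w (Suc i)"] Suc k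
    by (simp add: k_def[symmetric])
qed

text \<open>Dual to \<open>Rlet_head\<close>, counting left from the end of the block;
  \<open>num_runs p - k + 1\<close> translates \<open>k\<close> to the numbering from the
  right.\<close>

lemma Llet_psi_max:
  assumes occ: "occurrences p w \<noteq> {}" and k: "k \<in> {1..num_runs p}"
  shows "Llet w (psi_max p w (num_runs p - k + 1)) (length (run p k)) =
    letter (lexmax p w) (phi p k)"
proof (rule Llet_eqI)
  note max_occ = lexmax_properties(1)[OF occ]
  note b = phi_psi_bounds[OF k]
  have letters: "letter w (letter (lexmax p w) (phi p k)) = hd (run p k)"
    "letter w (letter (lexmax p w) (psi p k)) = hd (run p k)"
    using occurrencesD(3)[OF max_occ] letter_run[OF k] b by simp_all
  have eq: "psi_max p w (num_runs p - k + 1) = letter (lexmax p w) (psi p k)"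
    using psi_maxrun[OF occ, of "num_runs p - k"] k by (auto simp: psi_max_def)
  show "letter (lexmax p w) (phi p k) \<in> {1..psi_max p w (num_runs p - k + 1)}"
    unfolding eq using occurrences_le[OF max_occ b] occurrencesD(2)[OF max_occ, of "phi p k"] b
    by simp
  show "letter w (letter (lexmax p w) (phi p k)) = letter w (psi_max p w (num_runs p - k + 1))"
    unfolding eq using letters by simp
  show "card {t \<in> {letter (lexmax p w) (phi p k)..psi_max p w (num_runs p - k + 1)}.
      letter w t = letter w (psi_max p w (num_runs p - k + 1))} = length (run p k)"
    unfolding eq using letters_between_lexmax(2)[OF occ k] letters by simp
qed


section \<open>Letters contained in an occurrence\<close>

text \<open>The map sending \<open>j\<close> to \<open>num_runs p - j + 1\<close> is an involution
  on the run indices, so the existential may range over runs of \<open>p\<close> numbered from the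
  left.\<close>

lemma between_cond_iff:
  assumes occ: "occurrences p w \<noteq> {}"
  shows "between_cond p w l \<longleftrightarrow> (\<exists>k\<in>{1..num_runs p}.
    letter (lexmax p w) (phi p k) < l \<and> l < letter (lexmin p w) (psi p k))"
    (is "_ \<longleftrightarrow> (\<exists>k\<in>{1..?r}. ?Q k)")
proof -
  have iff: "Llet w (psi_max p w j) (length (run p (?r - j + 1))) < l \<and>
      l < Rlet w (phi w (head p w (?r - j + 1))) (length (run p (?r - j + 1))) \<longleftrightarrow>
    ?Q (?r - j + 1)" if "j \<in> {1..?r}" for j
  proof -
    have k: "?r - j + 1 \<in> {1..?r}" "?r - (?r - j + 1) + 1 = j"
      using that by auto
    show ?thesis
      using Llet_psi_max[OF occ k(1)] Rlet_head[OF occ k(1)] unfolding k(2) by simp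
  qed
  show ?thesis
  proof
    assume "between_cond p w l"
    then obtain j where "j \<in> {1..?r}" "?Q (?r - j + 1)"
      unfolding between_cond_def using iff by blast
    then show "\<exists>k\<in>{1..?r}. ?Q k"
      by (intro bexI[of _ "?r - j + 1"]) auto
  next
    assume "\<exists>k\<in>{1..?r}. ?Q k"
    then obtain k where k: "k \<in> {1..?r}" "?Q k"
      by blast
    then have "?r - k + 1 \<in> {1..?r}" "?r - (?r - k + 1) + 1 = k"
      by auto
    then show "between_cond p w l"
      unfolding between_cond_def using iff[of "?r - k + 1"] k(2) by metis
  qed
qed

lemma outer_cond_iff:
  assumes occ: "occurrences p w \<noteq> {}" and "1 \<le> num_runs p"
  shows "outer_cond p w l \<longleftrightarrow>
    l < letter (lexmin p w) (psi p 1) \<or> letter (lexmax p w) (phi p (num_runs p)) < l"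
proof -
  have "Llet w (psi_max p w 1) (length (run p (num_runs p))) =
      letter (lexmax p w) (phi p (num_runs p))"
    using Llet_psi_max[OF occ, of "num_runs p"] assms(2) by simp
  moreover have "Rlet w (phi w (head p w 1)) (length (run p 1)) = letter (lexmin p w) (psi p 1)"
    using Rlet_head[OF occ, of 1] assms(2) by simp
  ultimately show ?thesis
    by (simp add: outer_cond_def)
qed

text \<open>Let \<open>l\<close> be used for the \<open>k\<close>th run of \<open>p\<close>. By
  minimality it is not left of the \<open>k\<close>th block of \<open>lexmin p w\<close>; were it
  not right of the block's end, it would be one of the letters of that parity, all of which the
  block uses. The same argument applies to \<open>lexmax p w\<close>.\<close>

lemma contained_between:
  assumes occ: "is \<in> occurrences p w" and l: "l \<in> set is"
    and notL: "l \<notin> set (lexmin p w)" and notR: "l \<notin> set (lexmax p w)"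
  obtains k where "k \<in> {1..num_runs p}"
    "letter (lexmin p w) (psi p k) < l" "l < letter (lexmax p w) (phi p k)"
proof -
  have ne: "occurrences p w \<noteq> {}"
    using occ by blast
  note L = lexmin_properties[OF ne] and R = lexmax_properties[OF ne]
  obtain j where j: "j \<in> {1..length p}" "l = letter is j"
    using l occurrencesD(1)[OF occ] unfolding set_eq_letters[of "is"] by auto
  then obtain k where k: "k \<in> {1..num_runs p}" "j \<in> {phi p k..psi p k}"
    using ex_run by blast
  have hd: "letter w l = hd (run p k)"
    using letter_run[OF k] occurrencesD(3)[OF occ j(1)] j by simp
  note b = phi_psi_bounds[OF k(1)]
  have "letter (lexmin p w) (psi p k) < l"
  proof (rule ccontr)
    assume "\<not> letter (lexmin p w) (psi p k) < l"
    moreover have "letter (lexmin p w) (phi p k) \<le> l"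
      using occurrences_le[OF L(1), of "phi p k" j] L(2)[OF occ j(1)] j k b by auto
    ultimately have "l \<in> letter (lexmin p w) ` {phi p k..psi p k}"
      unfolding letters_between_lexmin(1)[OF ne k(1), symmetric] using hd by simp
    then show False
      using notL b unfolding set_eq_letters[of "lexmin p w"] occurrencesD(1)[OF L(1)] by auto
  qed
  moreover have "l < letter (lexmax p w) (phi p k)"
  proof (rule ccontr)
    assume "\<not> l < letter (lexmax p w) (phi p k)"
    moreover have "l \<le> letter (lexmax p w) (psi p k)"
      using occurrences_le[OF R(1), of j "psi p k"] R(2)[OF occ j(1)] j k b by auto
    ultimately have "l \<in> letter (lexmax p w) ` {phi p k..psi p k}"
      unfolding letters_between_lexmax(1)[OF ne k(1), symmetric] using hd by simp
    then show False
      using notR b unfolding set_eq_letters[of "lexmax p w"] occurrencesD(1)[OF R(1)] by auto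
  qed
  ultimately show ?thesis
    using that k(1) by blast
qed

section \<open>Splicing a letter between the extremal occurrences\<close>

lemma contained_if_splice:
  assumes "occurrences p w \<noteq> {}" "j \<in> {1..length p}" "l \<in> {1..length w}"
    and "letter w l = letter p j"
    and "\<And>i. \<lbrakk>1 \<le> i; i < j\<rbrakk> \<Longrightarrow> letter (lexmin p w) i < l"
    and "\<And>i. \<lbrakk>j < i; i \<le> length p\<rbrakk> \<Longrightarrow> l < letter (lexmax p w) i"
  shows "\<exists>is\<in>occurrences p w. l \<in> set is"
proof -
  obtain js where js: "js \<in> occurrences p w" "letter js j = l"
    using splice_occurrences[OF lexmin_properties(1) lexmax_properties(1)] assms by metis
  then have "l \<in> set js"
    unfolding set_eq_letters[of js] occurrencesD(1)[OF js(1)] using assms(2) by blast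
  then show ?thesis
    using js by blast
qed

text \<open>Consecutive runs of \<open>p\<close> carry the two different letters, so
  \<open>letter w l\<close> matches one of them and can stand at the position next to their common
  boundary.\<close>

lemma contained_between_runs:
  fixes p w :: "bool list"
  assumes occ: "occurrences p w \<noteq> {}" and l: "l \<in> {1..length w}"
    and k: "1 \<le> k" "k < num_runs p"
    and less: "letter (lexmin p w) (psi p k) < l" "l < letter (lexmax p w) (phi p (Suc k))"
  shows "\<exists>is\<in>occurrences p w. l \<in> set is"
proof -
  note min_occ = lexmin_properties(1)[OF occ] and max_occ = lexmax_properties(1)[OF occ]
  have k1: "k \<in> {1..num_runs p}" and k2: "Suc k \<in> {1..num_runs p}"
    using k by auto
  note b = phi_psi_bounds[OF k1] phi_psi_bounds[OF k2]
  have left: "letter (lexmin p w) i < l" if "1 \<le> i" "i \<le> psi p k" for i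
    using occurrences_le[OF min_occ, of i "psi p k"] that less b by auto
  have right: "l < letter (lexmax p w) i" if "phi p (Suc k) \<le> i" "i \<le> length p" for i
    using occurrences_le[OF max_occ, of "phi p (Suc k)" i] that less b by auto
  show ?thesis
  proof (cases "letter w l = hd (run p k)")
    case True
    then show ?thesis
      using b left right letter_phi_psi(2)[OF k1]
      by (intro contained_if_splice[OF occ _ l, of "psi p k"]) (auto simp: phi_Suc)
  next
    case False
    then have "letter w l = hd (run p (Suc k))"
      using hd_run_Suc[OF k] by auto
    then show ?thesis
      using b left right letter_phi_psi(1)[OF k2]
      by (intro contained_if_splice[OF occ _ l, of "phi p (Suc k)"]) (auto simp: phi_Suc)
  qed
qed

lemma not_contained_if_between_cond:
  assumes between: "between_cond p w l" and l: "l \<notin> set (lexmin p w)" "l \<notin> set (lexmax p w)"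
    and occ: "is \<in> occurrences p w"
  shows "l \<notin> set is"
proof
  assume "l \<in> set is"
  then obtain k where k: "k \<in> {1..num_runs p}"
    "letter (lexmin p w) (psi p k) < l" "l < letter (lexmax p w) (phi p k)"
    using contained_between[OF occ _ l] by blast
  have ne: "occurrences p w \<noteq> {}"
    using occ by blast
  obtain k' where k': "k' \<in> {1..num_runs p}"
    "letter (lexmax p w) (phi p k') < l" "l < letter (lexmin p w) (psi p k')"
    using between between_cond_iff[OF ne] by blast
  note b = phi_psi_bounds[OF k(1)] phi_psi_bounds[OF k'(1)]
  show False
  \<comment> \<open>If \<open>k\<close> \<le> \<open>k'\<close>, monotonicity of the block
    beginnings in \<open>lexmax p w\<close> gives the contradiction; otherwise monotonicity of the
    block ends in \<open>lexmin p w\<close> does.\<close>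
  proof (cases "k \<le> k'")
    case True
    then have "phi p k \<le> phi p k'"
      using b psi_less_phi[of k k' p] by (cases "k = k'") auto
    then have "letter (lexmax p w) (phi p k) \<le> letter (lexmax p w) (phi p k')"
      using b by (intro occurrences_le[OF lexmax_properties(1)[OF ne]]) auto
    then show False
      using k k' by simp
  next
    case False
    then have "psi p k' \<le> psi p k"
      by (simp add: psi_mono)
    then have "letter (lexmin p w) (psi p k') \<le> letter (lexmin p w) (psi p k)"
      using b by (intro occurrences_le[OF lexmin_properties(1)[OF ne]]) auto
    then show False
      using k k' by simp
  qed
qed

lemma not_contained_if_outer_cond:
  assumes outer: "outer_cond p w l" and l: "l \<notin> set (lexmin p w)" "l \<notin> set (lexmax p w)"
    and occ: "is \<in> occurrences p w"
  shows "l \<notin> set is"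
proof
  assume "l \<in> set is"
  then obtain k where k: "k \<in> {1..num_runs p}"
    "letter (lexmin p w) (psi p k) < l" "l < letter (lexmax p w) (phi p k)"
    using contained_between[OF occ _ l] by blast
  let ?r = "num_runs p"
  have ne: "occurrences p w \<noteq> {}" and ends: "1 \<in> {1..?r}" "?r \<in> {1..?r}"
    using occ k by auto
  note b = phi_psi_bounds[OF k(1)] phi_psi_bounds[OF ends(1)] phi_psi_bounds[OF ends(2)]
  have "letter (lexmin p w) (psi p 1) \<le> letter (lexmin p w) (psi p k)"
    using b k psi_mono[of 1 k p] by (intro occurrences_le[OF lexmin_properties(1)[OF ne]]) auto
  moreover have "phi p k \<le> phi p ?r"
    using b k psi_less_phi[of k ?r p] by (cases "k = ?r") auto
  then have "letter (lexmax p w) (phi p k) \<le> letter (lexmax p w) (phi p ?r)"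
    using b by (intro occurrences_le[OF lexmax_properties(1)[OF ne]]) auto
  ultimately show False
    using outer outer_cond_iff[OF ne] k ends by auto
qed

lemma contained_otherwise:
  assumes occ: "occurrences p w \<noteq> {}" and l: "l \<in> {1..length w}"
    and notin: "l \<notin> set (lexmin p w)" "l \<notin> set (lexmax p w)"
    and conds: "\<not> between_cond p w l" "\<not> outer_cond p w l" and mem: "letter w l \<in> set p"
  shows "\<exists>is\<in>occurrences p w. l \<in> set is"
proof -
  let ?r = "num_runs p" and ?L = "letter (lexmin p w)" and ?R = "letter (lexmax p w)"
  note min_occ = lexmin_properties(1)[OF occ] and max_occ = lexmax_properties(1)[OF occ]
  obtain j where j: "j \<in> {1..length p}" "letter w l = letter p j"
    using mem unfolding set_eq_letters[of p] by auto
  then obtain i where i: "i \<in> {1..?r}" "j \<in> {phi p i..psi p i}"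
    using ex_run by blast
  have neq: "?L t \<noteq> l" "?R t \<noteq> l" if "t \<in> {1..length p}" for t
    using notin that occurrencesD(1)[OF min_occ] occurrencesD(1)[OF max_occ]
    unfolding set_eq_letters[of "lexmin p w"] set_eq_letters[of "lexmax p w"] by auto
  have bounds: "psi p k \<in> {1..length p}" "phi p k \<in> {1..length p}" if "k \<in> {1..?r}" for k
    using phi_psi_bounds[OF that] by auto
  \<comment> \<open>As \<open>l\<close> lies in neither extremal occurrence, negating the weak
    inequalities yields strict ones.\<close>
  have alt: "l < ?R (phi p k) \<or> ?L (psi p k) < l" if "k \<in> {1..?r}" for k
    using conds(1) neq bounds[OF that] that unfolding between_cond_iff[OF occ]
    by (meson linorder_neqE_nat)
  have r: "1 \<in> {1..?r}" "?r \<in> {1..?r}"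
    using i by auto
  have outer: "?L (psi p 1) < l" "l < ?R (phi p ?r)"
    using conds(2) neq(1)[OF bounds(1)[OF r(1)]] neq(2)[OF bounds(2)[OF r(2)]] r
      outer_cond_iff[OF occ] by auto
  show ?thesis
  \<comment> \<open>With a single run there is no boundary to splice at. Here \<open>mem\<close>
    forces \<open>letter w l\<close> to be the only letter of \<open>p\<close>, and \<open>l\<close>
    takes the first position, followed by the tail of the maximal occurrence.\<close>
  proof (cases "?r = 1")
    case True
    then have "i = 1"
      using i by simp
    then have "letter w l = letter p 1"
      using letter_run[OF i] letter_phi_psi(1)[OF r(1)] j by (simp add: phi_def)
    moreover have "l < ?R t" if "1 < t" "t \<le> length p" for t
      using outer(2) True occurrences_le[OF max_occ, of 1 t] that by (simp add: phi_def)
    ultimately show ?thesis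
      using j by (intro contained_if_splice[OF occ _ l, of 1]) auto
  next
    case False
    \<comment> \<open>The set contains 1 because \<open>outer_cond\<close> fails and
      \<open>p\<close> has at least two runs, so its maximum exists.\<close>
    define K where "K = {k \<in> {1..<?r}. ?L (psi p k) < l}"
    define k where "k = Max K"
    have K: "finite K" "1 \<in> K"
      using outer(1) False r by (auto simp: K_def)
    then have k: "k \<in> K"
      unfolding k_def by (intro Max_in) auto
    \<comment> \<open>If \<open>Suc k\<close> is the last run, this is the failure of
      \<open>outer_cond\<close>; otherwise maximality of \<open>k\<close> rules out the second
      alternative in \<open>alt\<close>.\<close>
    have "l < ?R (phi p (Suc k))"
    proof (cases "Suc k = ?r")
      case False
      then have Sk: "Suc k < ?r"
        using k by (auto simp: K_def)
      have "Suc k \<notin> K"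
        using Max_ge[OF K(1), of "Suc k"] by (auto simp: k_def)
      then have "\<not> ?L (psi p (Suc k)) < l"
        using Sk by (auto simp: K_def)
      then show ?thesis
        using alt[of "Suc k"] Sk by auto
    qed (use outer(2) in simp)
    then show ?thesis
      using k by (intro contained_between_runs[OF occ l, of k]) (auto simp: K_def)
  qed
qed

theorem theorem3:
  fixes p w :: "bool list" and l :: nat
  assumes "occurrences p w \<noteq> {}"
    and "l \<in> {1..length w}"
    and "l \<notin> set (lexmin p w)"
    and "l \<notin> set (lexmax p w)"
  shows
    "(between_cond p w l \<longrightarrow> \<not> (\<exists>is\<in>occurrences p w. l \<in> set is)) \<and>
     (outer_cond p w l \<longrightarrow> \<not> (\<exists>is\<in>occurrences p w. l \<in> set is)) \<and>
     (\<not> between_cond p w l \<and> \<not> outer_cond p w l \<and> letter w l \<in> set p \<longrightarrow>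
        (\<exists>is\<in>occurrences p w. l \<in> set is))"
  using assms not_contained_if_between_cond not_contained_if_outer_cond contained_otherwise
  by blast

end
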